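(* Let $P \in \mathbb{R}^{n_u \times n_u}$ and $T \in \mathbb{R}^{n_p \times n_p}$ be symmetric positive definite matrices, and let $\delta_{AP}, \delta^{AP}, \delta_{QT}, \delta^{QT} > 0$ be constants, independent of the mesh size $h$, such that $$\delta_{AP} \le \frac{\langle Av, v\rangle}{\langle Pv, v\rangle} \le \delta^{AP} \quad \forall v \in \mathbb{R}^{n_u}\setminus\{0\}, \qquad \delta_{QT} \le \frac{\langle (Q + C_k) q, q\rangle}{\langle Tq, q\rangle} \le \delta^{QT} \quad \forall q \in \mathbb{R}^{n_p}\setminus\{0\}.$$ Assume the inf-sup condition with constant $c_1>0$ holds, and let $$c^q = \begin{cases} 1/(1-|\alpha|) & \text{if } -1/3 \le \alpha < 0,\\ 1 & \text{if } \alpha \ge 0,\end{cases} \qquad c_q = \min\left( \frac{c_1^2 + c_P k_* (1+|\alpha|)}{(1+|\alpha|)(1 + c_P k_* )},\ 1\right).$$ Consider the generalised eigenvalue problem $$\begin{bmatrix} A & B^T \\ B & -C_k \end{bmatrix}\begin{bmatrix} v \\ q\end{bmatrix} = \lambda \begin{bmatrix} P & 0 \\ 0 & T\end{bmatrix}\begin{bmatrix} v \\ q \end{bmatrix}, \qquad \begin{bmatrix} v \\ q \end{bmatrix} \neq 0 .$$ Then every eigenvalue $\lambda < 0$ satisfies $$-c^q \delta^{QT} \le \lambda \le \tfrac12\left(\delta_{AP} - \sqrt{\delta_{AP}^2 + 4 c_q \delta_{QT}\delta_{AP}}\right),$$ and every eigenvalue $\lambda > 0$ satisfies $$\delta_{AP}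 \le \lambda \le \delta^{AP} + c^q \delta^{QT}.$$
   Context: Setting. $\Omega \subset \mathbb{R}^d$, $d \in \{2,3\}$, is a bounded domain. $\alpha$ is a real constant with $-1/3 \le \alpha \le 1000$. $k:\Omega\to\mathbb{R}$ is a function with $0 \le k_* \le k(\mathbf{x}) \le k^*$ for all $\mathbf{x}\in\Omega$, where $k_*, k^*$ are constants. $\|\cdot\|$ denotes the $L^2(\Omega)$ norm (for scalar-, vector- or tensor-valued functions), $\langle\cdot,\cdot\rangle$ the Euclidean scalar product, and $\boldsymbol{\epsilon}(\mathbf{u}) = (\nabla \mathbf{u} + (\nabla\mathbf{u})^T)/2$. $L^2_0(\Omega)$ is the space of $L^2$ functions with zero mean. $\mathbf{X}_h \subset (H^1_0(\Omega))^d$ and $M_h \subset H^1(\Omega)\cap L^2_0(\Omega)$ are finite-dimensional (finite element) spaces associated with a triangulation of mesh size $h$, of dimensions $n_u$ and $n_p$, with fixed bases. Bilinear forms: $$a(\mathbf{u},\mathbf{v}) = \int_\Omega \boldsymbol{\epsilon}(\mathbf{u}):\boldsymbol{\epsilon}(\mathbf{v}) + \alpha (\nabla\cdot\mathbf{u})(\nabla\cdot\mathbf{v})\,dx,\quad b(p,\mathbf{v}) = -\int_\Omega p\,\nabla\cdot\mathbf{v}\,dx,\quad c(p,q) = \int_\Omega k \nabla p\cdot\nabla q\,dx.$$ Matrices: identifying coefficient vectors $v\in\mathbb{R}^{n_u}$, $q\in\mathbb{R}^{n_p}$ with functions $\mathbf{v}_h\in\mathbf{X}_h$, $q_h\in M_h$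 through the chosen bases, $A\in\mathbb{R}^{n_u\times n_u}$, $B\in\mathbb{R}^{n_p\times n_u}$, $C_k, Q\in\mathbb{R}^{n_p\times n_p}$ are the matrices with $\langle Au,v\rangle = a(\mathbf{u}_h,\mathbf{v}_h)$, $\langle Bv,q\rangle = b(q_h,\mathbf{v}_h)$, $\langle C_k p,q\rangle = c(p_h,q_h)$, and $\langle Qp,q\rangle = \int_\Omega p_h q_h\,dx$ (the pressure mass matrix). Inf-sup condition: there is a constant $c_1>0$, independent of $h$, with $$\max_{\mathbf{0}\ne\mathbf{v}_h\in\mathbf{X}_h}\frac{b(q_h,\mathbf{v}_h)}{\|\nabla\mathbf{v}_h\|}\ge c_1\|q_h\|\quad\forall q_h\in M_h.$$ $c_P>0$ is the Poincaré constant, in the form $c_P\|q\|^2\le\|\nabla q\|^2$ for all $q\in H^1(\Omega)\cap L^2_0(\Omega)$. *)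

theory Defs
  imports "HOL-Analysis.Analysis"
begin

section \<open>Lebesgue and Sobolev spaces on a domain\<close>

text \<open>Elements of \<open>L\<^sup>2(\<Omega>)\<close>, \<open>H\<^sup>1(\<Omega>)\<close>, \<open>H\<^sup>1\<^sub>0(\<Omega>)\<close> are represented by functions on
  the whole space, of which only the restriction to \<open>\<Omega>\<close> (up to null sets) matters.
  On \<^typ>\<open>real^'d\<close> and \<^typ>\<open>real^'d^'d\<close> the library norm and inner product are the
  Euclidean and the Frobenius ones.\<close>

definition domain :: "(real^'d) set \<Rightarrow> bool" where
  "domain \<Omega> \<longleftrightarrow> open \<Omega> \<and> connected \<Omega> \<and> \<Omega> \<noteq> {}"

definition L2 :: "(real^'d) set \<Rightarrow> (real^'d \<Rightarrow> 'a::euclidean_space) set" where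
  "L2 \<Omega> = {f. f \<in> borel_measurable (lebesgue_on \<Omega>) \<and>
              integrable (lebesgue_on \<Omega>) (\<lambda>x. (norm (f x))\<^sup>2)}"

definition L2_norm :: "(real^'d) set \<Rightarrow> (real^'d \<Rightarrow> 'a::euclidean_space) \<Rightarrow> real" where
  "L2_norm \<Omega> f = sqrt (LINT x|lebesgue_on \<Omega>. (norm (f x))\<^sup>2)"

definition L2_mean_zero :: "(real^'d) set \<Rightarrow> (real^'d \<Rightarrow> real) set" where
  "L2_mean_zero \<Omega> = {q \<in> L2 \<Omega>. (LINT x|lebesgue_on \<Omega>. q x) = 0}"

definition partial_deriv :: "'d \<Rightarrow> (real^'d \<Rightarrow> real) \<Rightarrow> real^'d \<Rightarrow> real" where
  "partial_deriv i f x = frechet_derivative f (at x) (axis i 1)"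

primrec C_diff :: "nat \<Rightarrow> (real^'d \<Rightarrow> real) \<Rightarrow> bool" where
  "C_diff 0 f \<longleftrightarrow> continuous_on UNIV f"
| "C_diff (Suc n) f \<longleftrightarrow> f differentiable_on UNIV \<and> (\<forall>i. C_diff n (partial_deriv i f))"

definition test_functions :: "(real^'d) set \<Rightarrow> (real^'d \<Rightarrow> real) set" where
  "test_functions \<Omega> =
     {f. (\<forall>n. C_diff n f) \<and> compact (closure {x. f x \<noteq> 0}) \<and> closure {x. f x \<noteq> 0} \<subseteq> \<Omega>}"

definition has_weak_gradient ::
    "(real^'d) set \<Rightarrow> (real^'d \<Rightarrow> real) \<Rightarrow> (real^'d \<Rightarrow> real^'d) \<Rightarrow> bool" where
  "has_weak_gradient \<Omega> u g \<longleftrightarrow> u \<in> L2 \<Omega> \<and> g \<in> L2 \<Omega> \<and>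
     (\<forall>f \<in> test_functions \<Omega>. \<forall>i.
        (LINT x|lebesgue_on \<Omega>. u x * partial_deriv i f x) = - (LINT x|lebesgue_on \<Omega>. g x $ i * f x))"

definition H1 :: "(real^'d) set \<Rightarrow> (real^'d \<Rightarrow> real) set" where
  "H1 \<Omega> = {u. \<exists>g. has_weak_gradient \<Omega> u g}"

text \<open>For open \<open>\<Omega>\<close> the weak gradient is unique up to null sets, so the choice below is
  immaterial in all integrals.\<close>

definition weak_grad :: "(real^'d) set \<Rightarrow> (real^'d \<Rightarrow> real) \<Rightarrow> real^'d \<Rightarrow> real^'d" where
  "weak_grad \<Omega> u = (SOME g. has_weak_gradient \<Omega> u g)"

text \<open>\<open>H\<^sup>1\<^sub>0(\<Omega>)\<close>: closure of the test functions in the \<open>H\<^sup>1\<close> norm.\<close>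

definition H1_0 :: "(real^'d) set \<Rightarrow> (real^'d \<Rightarrow> real) set" where
  "H1_0 \<Omega> = {u \<in> H1 \<Omega>. \<exists>f :: nat \<Rightarrow> real^'d \<Rightarrow> real.
     (\<forall>n. f n \<in> test_functions \<Omega>) \<and>
     (\<lambda>n. L2_norm \<Omega> (\<lambda>x. u x - f n x)) \<longlonglongrightarrow> 0 \<and>
     (\<lambda>n. L2_norm \<Omega> (\<lambda>x. weak_grad \<Omega> u x - (\<chi> i. partial_deriv i (f n) x))) \<longlonglongrightarrow> 0}"

definition H1_0_vec :: "(real^'d) set \<Rightarrow> (real^'d \<Rightarrow> real^'d) set" where
  "H1_0_vec \<Omega> = {u. \<forall>i. (\<lambda>x. u x $ i) \<in> H1_0 \<Omega>}"

text \<open>Row \<open>i\<close> of the Jacobian is the weak gradient of the component \<open>u\<^sub>i\<close>.\<close>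

definition vec_grad :: "(real^'d) set \<Rightarrow> (real^'d \<Rightarrow> real^'d) \<Rightarrow> real^'d \<Rightarrow> real^'d^'d" where
  "vec_grad \<Omega> u x = (\<chi> i. weak_grad \<Omega> (\<lambda>y. u y $ i) x)"

definition weak_div :: "(real^'d) set \<Rightarrow> (real^'d \<Rightarrow> real^'d) \<Rightarrow> real^'d \<Rightarrow> real" where
  "weak_div \<Omega> u x = trace (vec_grad \<Omega> u x)"

definition sym_grad :: "(real^'d) set \<Rightarrow> (real^'d \<Rightarrow> real^'d) \<Rightarrow> real^'d \<Rightarrow> real^'d^'d" where
  "sym_grad \<Omega> u x = (1/2) *\<^sub>R (vec_grad \<Omega> u x + transpose (vec_grad \<Omega> u x))"


section \<open>Bilinear forms\<close>

definition form_a ::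
    "(real^'d) set \<Rightarrow> real \<Rightarrow> (real^'d \<Rightarrow> real^'d) \<Rightarrow> (real^'d \<Rightarrow> real^'d) \<Rightarrow> real" where
  "form_a \<Omega> \<alpha> u v = (LINT x|lebesgue_on \<Omega>.
     sym_grad \<Omega> u x \<bullet> sym_grad \<Omega> v x + \<alpha> * weak_div \<Omega> u x * weak_div \<Omega> v x)"

definition form_b :: "(real^'d) set \<Rightarrow> (real^'d \<Rightarrow> real) \<Rightarrow> (real^'d \<Rightarrow> real^'d) \<Rightarrow> real" where
  "form_b \<Omega> p v = - (LINT x|lebesgue_on \<Omega>. p x * weak_div \<Omega> v x)"

definition form_c ::
    "(real^'d) set \<Rightarrow> (real^'d \<Rightarrow> real) \<Rightarrow> (real^'d \<Rightarrow> real) \<Rightarrow> (real^'d \<Rightarrow> real) \<Rightarrow> real" where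
  "form_c \<Omega> k p q = (LINT x|lebesgue_on \<Omega>. k x * (weak_grad \<Omega> p x \<bullet> weak_grad \<Omega> q x))"


section \<open>Finite-dimensional spaces with a basis\<close>

definition fe_fun :: "('n::finite \<Rightarrow> real^'d \<Rightarrow> 'a::real_vector) \<Rightarrow> real^'n \<Rightarrow> real^'d \<Rightarrow> 'a" where
  "fe_fun \<phi> v x = (\<Sum>i\<in>UNIV. (v $ i) *\<^sub>R \<phi> i x)"

definition ae_zero :: "(real^'d) set \<Rightarrow> (real^'d \<Rightarrow> 'a::real_vector) \<Rightarrow> bool" where
  "ae_zero \<Omega> f \<longleftrightarrow> (AE x in lebesgue_on \<Omega>. f x = 0)"

text \<open>Linear independence as elements of \<open>L\<^sup>2(\<Omega>)\<close>, i.e.\ modulo null sets.\<close>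

definition fe_basis ::
    "(real^'d) set \<Rightarrow> ('n::finite \<Rightarrow> real^'d \<Rightarrow> 'a::real_vector) \<Rightarrow> (real^'d \<Rightarrow> 'a) set \<Rightarrow> bool" where
  "fe_basis \<Omega> \<phi> X \<longleftrightarrow> X = range (fe_fun \<phi>) \<and> (\<forall>v. ae_zero \<Omega> (fe_fun \<phi> v) \<longrightarrow> v = 0)"

text \<open>The maximum over nonzero \<open>v\<close> is spelled out as an attained value; in the
  finite-dimensional space \<open>X \<noteq> {0}\<close> it always exists.\<close>

definition inf_sup ::
    "(real^'d) set \<Rightarrow> (real^'d \<Rightarrow> real^'d) set \<Rightarrow> (real^'d \<Rightarrow> real) set \<Rightarrow> real \<Rightarrow> bool" where
  "inf_sup \<Omega> X M c1 \<longleftrightarrow> (\<forall>q\<in>M. \<exists>v\<in>X. \<not> ae_zero \<Omega> v \<and>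
     (\<forall>w\<in>X. \<not> ae_zero \<Omega> w \<longrightarrow>
        form_b \<Omega> q w / L2_norm \<Omega> (vec_grad \<Omega> w) \<le> form_b \<Omega> q v / L2_norm \<Omega> (vec_grad \<Omega> v)) \<and>
     form_b \<Omega> q v / L2_norm \<Omega> (vec_grad \<Omega> v) \<ge> c1 * L2_norm \<Omega> q)"

definition poincare :: "(real^'d) set \<Rightarrow> real \<Rightarrow> bool" where
  "poincare \<Omega> cP \<longleftrightarrow>
     (\<forall>q \<in> H1 \<Omega> \<inter> L2_mean_zero \<Omega>. cP * (L2_norm \<Omega> q)\<^sup>2 \<le> (L2_norm \<Omega> (weak_grad \<Omega> q))\<^sup>2)"


section \<open>Matrices\<close>

definition sym_pos_def :: "real^'n^'n \<Rightarrow> bool" where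
  "sym_pos_def P \<longleftrightarrow> transpose P = P \<and> (\<forall>v. v \<noteq> 0 \<longrightarrow> (P *v v) \<bullet> v > 0)"

definition block_mat ::
    "'a^'n^'m \<Rightarrow> 'a^'k^'m \<Rightarrow> 'a^'n^'l \<Rightarrow> 'a^'k^'l \<Rightarrow> 'a^('n + 'k)^('m + 'l)" where
  "block_mat E F G H = (\<chi> i j.
     case i of
       Inl r \<Rightarrow> (case j of Inl s \<Rightarrow> E $ r $ s | Inr s \<Rightarrow> F $ r $ s)
     | Inr r \<Rightarrow> (case j of Inl s \<Rightarrow> G $ r $ s | Inr s \<Rightarrow> H $ r $ s))"

definition gen_eigenvalue :: "real^'n^'n \<Rightarrow> real^'n^'n \<Rightarrow> real \<Rightarrow> bool" where
  "gen_eigenvalue K N \<mu> \<longleftrightarrow> (\<exists>x. x \<noteq> 0 \<and> K *v x = \<mu> *\<^sub>R (N *v x))"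


section \<open>Constants\<close>

definition c_upper :: "real \<Rightarrow> real" where
  "c_upper \<alpha> = (if -1/3 \<le> \<alpha> \<and> \<alpha> < 0 then 1 / (1 - \<bar>\<alpha>\<bar>) else 1)"

definition c_lower :: "real \<Rightarrow> real \<Rightarrow> real \<Rightarrow> real \<Rightarrow> real" where
  "c_lower \<alpha> c1 cP k_low =
     min ((c1\<^sup>2 + cP * k_low * (1 + \<bar>\<alpha>\<bar>)) / ((1 + \<bar>\<alpha>\<bar>) * (1 + cP * k_low))) 1"

end

theory Submission
  imports Defs
begin

text \<open>On \<open>H\<^sup>1\<^sub>0\<close> two integrations by parts against approximating test functions give
  \<open>\<integral> \<partial>\<^sub>i u \<partial>\<^sub>j v = \<integral> \<partial>\<^sub>j u \<partial>\<^sub>i v\<close>, hence Korn's identity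
  \<open>2 \<parallel>\<epsilon>(u)\<parallel>\<^sup>2 = \<parallel>\<nabla>u\<parallel>\<^sup>2 + \<parallel>div u\<parallel>\<^sup>2\<close> and \<open>\<parallel>div u\<parallel> \<le> \<parallel>\<nabla>u\<parallel>\<close>. So
  \<open>\<parallel>div u\<parallel>\<^sup>2 \<le> c\<^sup>q a(u,u)\<close> and \<open>a(u,u) \<le> (1 + \<bar>\<alpha>\<bar>) \<parallel>\<nabla>u\<parallel>\<^sup>2\<close>; these bound the Schur complement
  \<open>B A\<^sup>-\<^sup>1 B\<^sup>T\<close> from above by \<open>c\<^sup>q Q\<close> and, with the inf-sup condition, from below by
  \<open>c\<^sub>1\<^sup>2 / (1 + \<bar>\<alpha>\<bar>) Q\<close>. The eigenvalue bounds follow by testing the two block rows with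
  \<open>v\<close> and \<open>q\<close>.\<close>

section \<open>Square-integrable functions: Cauchy-Schwarz and closure properties\<close>

text \<open>Shared core of the two Cauchy-Schwarz inequalities, for \<open>L2 \<Omega>\<close> and
  for a semidefinite matrix. The leading coefficient may vanish there, hence the separate case
  \<open>c = 0\<close>.\<close>

lemma quadratic_nonneg_imp_discriminant:
  fixes a b c :: real
  assumes "\<And>t. 0 \<le> a + 2 * b * t + c * t\<^sup>2"
  shows "b\<^sup>2 \<le> a * c"
proof (cases "c = 0")
  case True
  have "b = 0"
  proof (rule ccontr)
    assume "b \<noteq> 0"
    \<comment> \<open>With \<open>c = 0\<close> the expression is affine in \<open>t\<close> and
      takes the value -1 at this point.\<close>
    then show False
      using assms[of "- (a + 1) / (2 * b)"] True by simp
  qed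
  then show ?thesis using True by simp
next
  case False
  have "c > 0"
  proof (rule ccontr)
    assume "\<not> c > 0"
    with False have c: "c < 0" by simp
    have "0 \<le> a" using assms[of 0] by simp
    \<comment> \<open>Adding the values at \<open>t\<close> and \<open>-t\<close> cancels the linear
      term.\<close>
    have *: "0 \<le> a + c * t\<^sup>2" for t
      using assms[of t] assms[of "-t"] by simp
    have "c * (sqrt ((a + 1) / -c))\<^sup>2 = - (a + 1)"
      using c \<open>0 \<le> a\<close> by (subst real_sqrt_pow2) (auto simp: divide_nonneg_neg field_simps)
    with *[of "sqrt ((a + 1) / -c)"] show False by simp
  qed
  \<comment> \<open>Evaluation at the minimiser of the quadratic.\<close>
  have "0 \<le> a + 2 * b * (- b / c) + c * (- b / c)\<^sup>2" by (rule assms)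
  also have "\<dots> = a - b\<^sup>2 / c" using False by (simp add: power2_eq_square field_simps)
  finally show ?thesis using \<open>c > 0\<close> by (simp add: field_simps)
qed

lemma integrable_inner_L2:
  assumes "f \<in> L2 \<Omega>" "g \<in> L2 \<Omega>"
  shows "integrable (lebesgue_on \<Omega>) (\<lambda>x. f x \<bullet> g x)"
proof (rule Bochner_Integration.integrable_bound)
  show "integrable (lebesgue_on \<Omega>) (\<lambda>x. (norm (f x))\<^sup>2 + (norm (g x))\<^sup>2)"
    using assms by (auto simp: L2_def)
  show "(\<lambda>x. f x \<bullet> g x) \<in> borel_measurable (lebesgue_on \<Omega>)"
    using assms by (auto simp: L2_def)
  have "\<bar>x \<bullet> y\<bar> \<le> (norm x)\<^sup>2 + (norm y)\<^sup>2" for x y :: 'b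
  proof -
    have "\<bar>x \<bullet> y\<bar> \<le> norm x * norm y" by (rule Cauchy_Schwarz_ineq2)
    also have "\<dots> \<le> (norm x)\<^sup>2 + (norm y)\<^sup>2"
      using sum_squares_bound[of "norm x" "norm y"] mult_nonneg_nonneg[OF norm_ge_zero norm_ge_zero, of x y]
      unfolding mult.assoc by linarith
    finally show ?thesis .
  qed
  then show "AE x in lebesgue_on \<Omega>. norm (f x \<bullet> g x) \<le> norm ((norm (f x))\<^sup>2 + (norm (g x))\<^sup>2)"
    by auto
qed

lemma L2_norm_power2: "(L2_norm \<Omega> f)\<^sup>2 = (LINT x|lebesgue_on \<Omega>. f x \<bullet> f x)"
  by (simp add: L2_norm_def power2_norm_eq_inner)

lemma L2_norm_nonneg: "0 \<le> L2_norm \<Omega> f"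
  by (simp add: L2_norm_def)

lemma L2_Cauchy_Schwarz:
  assumes f: "f \<in> L2 \<Omega>" and g: "g \<in> L2 \<Omega>"
  shows "(LINT x|lebesgue_on \<Omega>. f x \<bullet> g x)\<^sup>2 \<le> (L2_norm \<Omega> f)\<^sup>2 * (L2_norm \<Omega> g)\<^sup>2"
proof (rule quadratic_nonneg_imp_discriminant)
  fix t :: real
  note [simp] = integrable_inner_L2[OF f f] integrable_inner_L2[OF g g] integrable_inner_L2[OF f g]
  have "0 \<le> (LINT x|lebesgue_on \<Omega>. (f x + t *\<^sub>R g x) \<bullet> (f x + t *\<^sub>R g x))"
    by (rule integral_nonneg_AE) simp
  also have "\<dots> = (LINT x|lebesgue_on \<Omega>. f x \<bullet> f x + 2 * t * (f x \<bullet> g x) + t\<^sup>2 * (g x \<bullet> g x))"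
    by (rule Bochner_Integration.integral_cong)
      (auto simp: inner_add inner_commute power2_eq_square algebra_simps)
  also have "\<dots> = (L2_norm \<Omega> f)\<^sup>2 + 2 * (LINT x|lebesgue_on \<Omega>. f x \<bullet> g x) * t + (L2_norm \<Omega> g)\<^sup>2 * t\<^sup>2"
    by (simp add: L2_norm_power2)
  finally show "0 \<le> (L2_norm \<Omega> f)\<^sup>2 + 2 * (LINT x|lebesgue_on \<Omega>. f x \<bullet> g x) * t + (L2_norm \<Omega> g)\<^sup>2 * t\<^sup>2" .
qed

lemma L2_diff:
  assumes f: "f \<in> L2 \<Omega>" and g: "g \<in> L2 \<Omega>"
  shows "(\<lambda>x. f x - g x) \<in> L2 \<Omega>"
proof -
  note [simp] = integrable_inner_L2[OF f f] integrable_inner_L2[OF g g] integrable_inner_L2[OF f g]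
  have "integrable (lebesgue_on \<Omega>) (\<lambda>x. f x \<bullet> f x - 2 * (f x \<bullet> g x) + g x \<bullet> g x)"
    by simp
  moreover have "(\<lambda>x. f x \<bullet> f x - 2 * (f x \<bullet> g x) + g x \<bullet> g x) = (\<lambda>x. (norm (f x - g x))\<^sup>2)"
    by (auto simp: power2_norm_eq_inner inner_diff inner_commute)
  ultimately show ?thesis
    using assms by (auto simp: L2_def)
qed

lemma L2_bounded_linear_image:
  assumes f: "f \<in> L2 \<Omega>" and h: "bounded_linear h"
  shows "(\<lambda>x. h (f x)) \<in> L2 \<Omega>"
proof -
  obtain K where K: "\<And>y. norm (h y) \<le> norm y * K" "K > 0"
    using bounded_linear.pos_bounded[OF h] by blast
  have m: "(\<lambda>x. h (f x)) \<in> borel_measurable (lebesgue_on \<Omega>)"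
    using f borel_measurable_continuous_onI[OF linear_continuous_on[OF h]]
    by (auto simp: L2_def)
  have "integrable (lebesgue_on \<Omega>) (\<lambda>x. (norm (h (f x)))\<^sup>2)"
  proof (rule Bochner_Integration.integrable_bound)
    show "integrable (lebesgue_on \<Omega>) (\<lambda>x. K\<^sup>2 * (norm (f x))\<^sup>2)"
      using f by (auto simp: L2_def)
    have "(norm (h y))\<^sup>2 \<le> K\<^sup>2 * (norm y)\<^sup>2" for y
      using power_mono[OF K(1)[of y], of 2] by (simp add: power_mult_distrib mult.commute)
    then show "AE x in lebesgue_on \<Omega>. norm ((norm (h (f x)))\<^sup>2) \<le> norm (K\<^sup>2 * (norm (f x))\<^sup>2)"
      by simp
  qed (use m in simp)
  with m show ?thesis by (simp add: L2_def)
qed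

lemma L2_vec_lambda:
  fixes f :: "'m::finite \<Rightarrow> real^'d \<Rightarrow> 'a::euclidean_space"
  assumes f: "\<And>i. f i \<in> L2 \<Omega>"
  shows "(\<lambda>x. \<chi> i. f i x) \<in> L2 \<Omega>"
proof -
  have "(\<lambda>x. \<chi> i. f i x) \<in> borel_measurable (lebesgue_on \<Omega>)"
    using f by (subst borel_measurable_euclidean_space)
      (auto simp: Basis_vec_def inner_axis L2_def intro!: borel_measurable_inner)
  moreover have "(\<lambda>x. (norm (\<chi> i. f i x))\<^sup>2) = (\<lambda>x. \<Sum>i\<in>UNIV. (norm (f i x))\<^sup>2)"
    by (simp add: norm_vec_def L2_set_def sum_nonneg)
  moreover have "integrable (lebesgue_on \<Omega>) (\<lambda>x. \<Sum>i\<in>UNIV. (norm (f i x))\<^sup>2)"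
    using f by (auto simp: L2_def)
  ultimately show ?thesis by (simp add: L2_def)
qed

text \<open>\<open>f\<close> is bounded on the compact closure of \<open>\<Omega>\<close>, and
  \<open>\<Omega>\<close> has finite measure.\<close>

lemma L2_continuous:
  fixes f :: "real^'d \<Rightarrow> real"
  assumes \<Omega>: "open \<Omega>" "bounded \<Omega>" and f: "continuous_on UNIV f"
  shows "f \<in> L2 \<Omega>"
proof -
  have meas: "f \<in> borel_measurable (lebesgue_on \<Omega>)"
    using \<Omega> f by (intro continuous_imp_measurable_on_sets_lebesgue)
      (auto intro: continuous_on_subset)
  have "bounded (f ` closure \<Omega>)"
    using \<Omega> f by (intro compact_imp_bounded compact_continuous_image)
      (auto intro: continuous_on_subset simp: compact_closure)
  then obtain K where K: "\<And>x. x \<in> \<Omega> \<Longrightarrow> norm (f x) \<le> K"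
    unfolding bounded_iff using closure_subset by fastforce
  interpret finite_measure "lebesgue_on \<Omega>"
    using \<Omega> by (intro finite_measure_lebesgue_on) (simp add: lmeasurable_open)
  have "integrable (lebesgue_on \<Omega>) (\<lambda>x. (norm (f x))\<^sup>2)"
  proof (rule integrable_const_bound)
    show "AE x in lebesgue_on \<Omega>. norm ((norm (f x))\<^sup>2) \<le> K\<^sup>2"
      using K by (intro AE_I2) (auto intro: power_mono simp: abs_le_square_iff[symmetric] dest!: K)
  qed (use meas in simp)
  with meas show ?thesis by (simp add: L2_def)
qed

section \<open>Symmetry of mixed second derivatives\<close>

lemma partial_deriv_has_real_derivative:
  assumes "f differentiable_on UNIV"
  shows "((\<lambda>t. f (x + t *\<^sub>R axis i 1)) has_real_derivative partial_deriv i f (x + t *\<^sub>R axis i 1)) (at t)"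
proof -
  let ?F = "frechet_derivative f (at (x + t *\<^sub>R axis i 1))"
  have F: "(f has_derivative ?F) (at (x + t *\<^sub>R axis i 1))"
    using assms by (simp add: differentiable_on_def frechet_derivative_works[symmetric])
  have "((\<lambda>t. f (x + t *\<^sub>R axis i 1)) has_derivative (\<lambda>s. ?F (s *\<^sub>R axis i 1))) (at t)"
    by (rule has_derivative_compose[where g = f and f = "\<lambda>t. x + t *\<^sub>R axis i 1", OF _ F]) (auto intro!: derivative_eq_intros)
  moreover have "?F (s *\<^sub>R axis i 1) = ?F (axis i 1) * s" for s
    using linear_scale[OF has_derivative_linear[OF F]] by (simp add: mult.commute)
  ultimately show ?thesis
    by (simp add: has_field_derivative_def partial_deriv_def mult_commute_abs)
qed

text \<open>The mean value theorem is applied twice: along axis \<open>i\<close> to the difference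
  of \<open>f\<close> across the shift along axis \<open>j\<close>, then along axis \<open>j\<close>
  to \<open>partial_deriv i f\<close>. The left side of the equation is symmetric in
  \<open>i\<close> and \<open>j\<close>.\<close>

lemma mixed_difference_mean_value:
  fixes f :: "real^'d \<Rightarrow> real"
  assumes f: "f differentiable_on UNIV" and fi: "partial_deriv i f differentiable_on UNIV"
    and s: "s > 0"
  shows "\<exists>y. norm (y - x) \<le> 2 * s \<and>
    f (x + s *\<^sub>R axis i 1 + s *\<^sub>R axis j 1) - f (x + s *\<^sub>R axis i 1) - f (x + s *\<^sub>R axis j 1) + f x
      = s\<^sup>2 * partial_deriv j (partial_deriv i f) y"
proof -
  let ?g = "\<lambda>t. f ((x + s *\<^sub>R axis j 1) + t *\<^sub>R axis i 1) - f (x + t *\<^sub>R axis i 1)"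
  let ?g' = "\<lambda>t. partial_deriv i f ((x + s *\<^sub>R axis j 1) + t *\<^sub>R axis i 1) - partial_deriv i f (x + t *\<^sub>R axis i 1)"
  have "\<exists>z. 0 < z \<and> z < s \<and> ?g s - ?g 0 = (s - 0) * ?g' z"
    using s by (intro MVT2 DERIV_diff partial_deriv_has_real_derivative f)
  then obtain z where z: "0 < z" "z < s" "?g s - ?g 0 = s * ?g' z" by auto
  let ?h = "\<lambda>t. partial_deriv i f ((x + z *\<^sub>R axis i 1) + t *\<^sub>R axis j 1)"
  let ?h' = "\<lambda>t. partial_deriv j (partial_deriv i f) ((x + z *\<^sub>R axis i 1) + t *\<^sub>R axis j 1)"
  have "\<exists>w. 0 < w \<and> w < s \<and> ?h s - ?h 0 = (s - 0) * ?h' w"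
    using s by (intro MVT2 partial_deriv_has_real_derivative fi)
  then obtain w where w: "0 < w" "w < s" "?h s - ?h 0 = s * ?h' w" by auto
  let ?y = "(x + z *\<^sub>R axis i 1) + w *\<^sub>R axis j 1"
  have "norm (?y - x) \<le> norm (z *\<^sub>R axis i (1::real)) + norm (w *\<^sub>R axis j (1::real))"
    using norm_triangle_ineq[of "z *\<^sub>R axis i (1::real)" "w *\<^sub>R axis j (1::real)"] by (simp add: add.assoc)
  also have "\<dots> \<le> 2 * s" using z w by simp
  finally have "norm (?y - x) \<le> 2 * s" .
  moreover have "?g' z = s * ?h' w"
    using w(3) by (simp add: algebra_simps)
  then have "?g s - ?g 0 = s\<^sup>2 * ?h' w" using z(3) by (simp add: power2_eq_square)
  then have "f (x + s *\<^sub>R axis i 1 + s *\<^sub>R axis j 1) - f (x + s *\<^sub>R axis i 1) - f (x + s *\<^sub>R axis j 1) + f x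
      = s\<^sup>2 * partial_deriv j (partial_deriv i f) ?y" by (simp add: algebra_simps)
  ultimately show ?thesis by blast
qed

text \<open>Schwarz's theorem: by symmetry of the second difference the two mixed derivatives take
  equal values at points \<open>y n\<close> and \<open>z n\<close> that both tend to
  \<open>x\<close>, and continuity carries the equality to \<open>x\<close>.\<close>

lemma partial_deriv_commute:
  fixes f :: "real^'d \<Rightarrow> real"
  assumes f: "C_diff 2 f"
  shows "partial_deriv j (partial_deriv i f) = partial_deriv i (partial_deriv j f)"
proof
  fix x
  have d: "f differentiable_on UNIV" "\<And>i. partial_deriv i f differentiable_on UNIV"
    and c: "\<And>i j. continuous_on UNIV (partial_deriv j (partial_deriv i f))"
    using f by (auto simp: numeral_2_eq_2)
  let ?s = "\<lambda>n. inverse (real (Suc n))"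
  have "\<exists>y z. norm (y - x) \<le> 2 * ?s n \<and> norm (z - x) \<le> 2 * ?s n \<and>
      partial_deriv j (partial_deriv i f) y = partial_deriv i (partial_deriv j f) z" for n
  proof -
    have s: "?s n > 0" by simp
    from mixed_difference_mean_value[OF d(1) d(2) s, of x i j]
    obtain y where y: "norm (y - x) \<le> 2 * ?s n"
      "f (x + ?s n *\<^sub>R axis i 1 + ?s n *\<^sub>R axis j 1) - f (x + ?s n *\<^sub>R axis i 1) - f (x + ?s n *\<^sub>R axis j 1) + f x
        = (?s n)\<^sup>2 * partial_deriv j (partial_deriv i f) y" by blast
    from mixed_difference_mean_value[OF d(1) d(2) s, of x j i]
    obtain z where z: "norm (z - x) \<le> 2 * ?s n"
      "f (x + ?s n *\<^sub>R axis j 1 + ?s n *\<^sub>R axis i 1) - f (x + ?s n *\<^sub>R axis j 1) - f (x + ?s n *\<^sub>R axis i 1) + f x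
        = (?s n)\<^sup>2 * partial_deriv i (partial_deriv j f) z" by blast
    have "(?s n)\<^sup>2 * partial_deriv j (partial_deriv i f) y = (?s n)\<^sup>2 * partial_deriv i (partial_deriv j f) z"
      using y(2) z(2) by (simp add: algebra_simps)
    then show ?thesis using y(1) z(1) s by auto
  qed
  then obtain y z where yz: "\<And>n. norm (y n - x) \<le> 2 * ?s n" "\<And>n. norm (z n - x) \<le> 2 * ?s n"
    "\<And>n. partial_deriv j (partial_deriv i f) (y n) = partial_deriv i (partial_deriv j f) (z n)"
    by metis
  have lim: "(\<lambda>n. 2 * ?s n) \<longlonglongrightarrow> 0"
    using tendsto_mult_right_zero[OF LIMSEQ_inverse_real_of_nat, of 2] by simp
  have "y \<longlonglongrightarrow> x" "z \<longlonglongrightarrow> x"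
    using yz(1,2) by (auto intro!: LIM_zero_cancel Lim_null_comparison[OF _ lim])
  then have "(\<lambda>n. partial_deriv j (partial_deriv i f) (y n)) \<longlonglongrightarrow> partial_deriv j (partial_deriv i f) x"
    and "(\<lambda>n. partial_deriv i (partial_deriv j f) (z n)) \<longlonglongrightarrow> partial_deriv i (partial_deriv j f) x"
    using c by (auto intro!: continuous_on_tendsto_compose[OF c])
  then show "partial_deriv j (partial_deriv i f) x = partial_deriv i (partial_deriv j f) x"
    using yz(3) LIMSEQ_unique by simp
qed

section \<open>Test functions and weak gradients\<close>

lemma partial_deriv_test_function:
  assumes "f \<in> test_functions \<Omega>"
  shows "partial_deriv i f \<in> test_functions \<Omega>"
proof -
  let ?S = "closure {x. f x \<noteq> 0}"
  have f: "\<And>n. C_diff n f" "compact ?S" "?S \<subseteq> \<Omega>" using assms by (auto simp: test_functions_def)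
  have "C_diff n (partial_deriv i f)" for n using f(1)[of "Suc n"] by simp
  moreover have "partial_deriv i f x = 0" if "x \<notin> ?S" for x
  proof -
    \<comment> \<open>Off the closed set \<open>?S\<close> the function vanishes on a whole
      neighbourhood.\<close>
    have "(f has_derivative (\<lambda>_. 0)) (at x)"
    proof (rule has_derivative_transform_within_open)
      show "((\<lambda>_. 0) has_derivative (\<lambda>_. 0)) (at x)" by simp
      show "open (- ?S)" by auto
      show "0 = f y" if "y \<in> - ?S" for y
        using that closure_subset[of "{x. f x \<noteq> 0}"] by auto
    qed (use that in auto)
    then show ?thesis by (simp add: partial_deriv_def frechet_derivative_at[symmetric])
  qed
  then have "closure {x. partial_deriv i f x \<noteq> 0} \<subseteq> ?S"
    by (intro closure_minimal) auto
  moreover from this have "compact (closure {x. partial_deriv i f x \<noteq> 0})"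
    using compact_Int_closed[OF f(2) closed_closure] by (metis inf.absorb_iff2)
  ultimately show ?thesis
    using f(3) by (auto simp: test_functions_def)
qed

lemma weak_grad_works: "u \<in> H1 \<Omega> \<Longrightarrow> has_weak_gradient \<Omega> u (weak_grad \<Omega> u)"
  unfolding H1_def weak_grad_def by (simp add: someI_ex)

lemma weak_grad_L2: "u \<in> H1 \<Omega> \<Longrightarrow> weak_grad \<Omega> u \<in> L2 \<Omega>"
  using weak_grad_works by (auto simp: has_weak_gradient_def)

lemma test_function_gradient_L2:
  assumes "open \<Omega>" "bounded \<Omega>" "f \<in> test_functions \<Omega>"
  shows "(\<lambda>x. \<chi> i. partial_deriv i f x) \<in> L2 \<Omega>"
proof (rule L2_vec_lambda)
  fix i
  have "C_diff 0 (partial_deriv i f)"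
    using partial_deriv_test_function[OF assms(3)] by (simp only: test_functions_def mem_Collect_eq)
  then show "partial_deriv i f \<in> L2 \<Omega>"
    using assms by (intro L2_continuous) auto
qed

text \<open>With \<open>partial_deriv i f\<close> and \<open>partial_deriv j f\<close> themselves as
  test functions, both sides become minus the integral of \<open>v\<close> against the same mixed
  second derivative of \<open>f\<close>.\<close>

lemma integral_weak_grad_test_swap:
  assumes v: "v \<in> H1 \<Omega>" and f: "f \<in> test_functions \<Omega>"
  shows "(LINT x|lebesgue_on \<Omega>. weak_grad \<Omega> v x $ j * partial_deriv i f x) =
         (LINT x|lebesgue_on \<Omega>. weak_grad \<Omega> v x $ i * partial_deriv j f x)"
proof -
  have *: "(LINT x|lebesgue_on \<Omega>. v x * partial_deriv j (partial_deriv i f) x) =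
      - (LINT x|lebesgue_on \<Omega>. weak_grad \<Omega> v x $ j * partial_deriv i f x)" for i j
    using weak_grad_works[OF v] partial_deriv_test_function[OF f] by (auto simp: has_weak_gradient_def)
  have "C_diff 2 f" using f by (auto simp: test_functions_def)
  from partial_deriv_commute[OF this, of j i] *[of i j] *[of j i] show ?thesis by simp
qed

text \<open>The identity holds when the gradient of \<open>u\<close> is replaced by that of a test
  function. Such gradients approximate \<open>weak_grad \<Omega> u\<close> in the
  \<open>L2_norm\<close>, and Cauchy-Schwarz passes the identity to the limit.\<close>

lemma integral_weak_grad_swap:
  fixes \<Omega> :: "(real^'d) set"
  assumes \<Omega>: "open \<Omega>" "bounded \<Omega>" and u: "u \<in> H1_0 \<Omega>" and v: "v \<in> H1 \<Omega>"
  shows "(LINT x|lebesgue_on \<Omega>. weak_grad \<Omega> u x $ i * weak_grad \<Omega> v x $ j) =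
         (LINT x|lebesgue_on \<Omega>. weak_grad \<Omega> u x $ j * weak_grad \<Omega> v x $ i)"
proof -
  define G where "G = weak_grad \<Omega> u"
  define V where "V = weak_grad \<Omega> v"
  \<comment> \<open>Pairing a vector field with \<open>W\<close> yields the difference of the two
    integrands, so the claim becomes \<open>I = 0\<close>.\<close>
  define W :: "real^'d \<Rightarrow> real^'d" where "W = (\<lambda>x. (V x $ j) *\<^sub>R axis i 1 - (V x $ i) *\<^sub>R axis j 1)"
  have GW: "y \<bullet> W x = y $ i * V x $ j - y $ j * V x $ i" for x y
    by (simp add: W_def inner_diff_right inner_axis)
  have G: "G \<in> L2 \<Omega>" using u by (auto simp: G_def H1_0_def weak_grad_L2)
  have V: "V \<in> L2 \<Omega>" using v by (auto simp: V_def weak_grad_L2)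
  have comp: "(\<lambda>x. F x $ l) \<in> L2 \<Omega>" if "F \<in> L2 \<Omega>" for F :: "real^'d \<Rightarrow> real^'d" and l
    using L2_bounded_linear_image[OF that bounded_linear_vec_nth] .
  have int: "integrable (lebesgue_on \<Omega>) (\<lambda>x. F x $ l * V x $ m)" if "F \<in> L2 \<Omega>" for F :: "real^'d \<Rightarrow> real^'d" and l m
    using integrable_inner_L2[OF comp[OF that] comp[OF V]] by simp
  have W: "W \<in> L2 \<Omega>"
    unfolding W_def
    by (intro L2_diff L2_bounded_linear_image[OF _ bounded_linear_scaleR_left] comp V)
  obtain f where f: "\<And>n. f n \<in> test_functions \<Omega>"
    and lim: "(\<lambda>n. L2_norm \<Omega> (\<lambda>x. G x - (\<chi> i. partial_deriv i (f n) x))) \<longlonglongrightarrow> 0"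
    using u by (auto simp: H1_0_def G_def)
  define D :: "nat \<Rightarrow> real^'d \<Rightarrow> real^'d" where "D = (\<lambda>n x. \<chi> i. partial_deriv i (f n) x)"
  have D: "D n \<in> L2 \<Omega>" for n
    unfolding D_def by (rule test_function_gradient_L2[OF \<Omega> f])
  define I where "I = (LINT x|lebesgue_on \<Omega>. G x \<bullet> W x)"
  have "I\<^sup>2 \<le> (L2_norm \<Omega> (\<lambda>x. G x - D n x))\<^sup>2 * (L2_norm \<Omega> W)\<^sup>2" for n
  proof -
    \<comment> \<open>Gradients of test functions are orthogonal to \<open>W\<close>, so
      \<open>I\<close> sees only the approximation error \<open>G - D n\<close>.\<close>
    have "(LINT x|lebesgue_on \<Omega>. D n x \<bullet> W x) = 0"
      unfolding GW using integral_weak_grad_test_swap[OF v f, of j i n]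
      by (simp add: Bochner_Integration.integral_diff[OF int int] D) (simp add: D_def V_def mult.commute)
    then have "I = (LINT x|lebesgue_on \<Omega>. (G x - D n x) \<bullet> W x)"
      by (simp add: I_def inner_diff_left Bochner_Integration.integral_diff[OF integrable_inner_L2 integrable_inner_L2] G D W)
    then show ?thesis using L2_Cauchy_Schwarz[OF L2_diff[OF G D] W] by simp
  qed
  moreover have "(\<lambda>n. (L2_norm \<Omega> (\<lambda>x. G x - D n x))\<^sup>2 * (L2_norm \<Omega> W)\<^sup>2) \<longlonglongrightarrow> 0\<^sup>2 * (L2_norm \<Omega> W)\<^sup>2"
    using lim unfolding D_def by (intro tendsto_intros)
  ultimately have "I\<^sup>2 \<le> 0" by (intro LIMSEQ_le_const) auto
  then have "I = 0" by simp
  then show ?thesis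
    unfolding I_def GW by (simp add: Bochner_Integration.integral_diff[OF int int] G) (simp add: G_def V_def)
qed


section \<open>Korn's identity and estimates for the bilinear forms\<close>

lemma inner_transpose_transpose:
  fixes G H :: "real^'n^'n"
  shows "transpose G \<bullet> transpose H = G \<bullet> H"
  by (simp add: inner_vec_def transpose_def) (rule sum.swap)

text \<open>Pointwise half of Korn's identity; the term \<open>G \<bullet> transpose G\<close> turns
  into the squared divergence only after integration.\<close>

lemma inner_sym_part:
  fixes G :: "real^'n^'n"
  shows "((1/2) *\<^sub>R (G + transpose G)) \<bullet> ((1/2) *\<^sub>R (G + transpose G)) = (G \<bullet> G + G \<bullet> transpose G) / 2"
  using inner_transpose_transpose[of G G] inner_transpose_transpose[of G "transpose G"]
  by (simp add: inner_add field_simps)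

text \<open>Cauchy-Schwarz, as transposition preserves the Frobenius norm.\<close>

lemma inner_transpose_le:
  fixes G :: "real^'n^'n"
  shows "G \<bullet> transpose G \<le> G \<bullet> G"
  using norm_cauchy_schwarz[of G "transpose G"] inner_transpose_transpose[of G G]
  by (simp add: norm_eq_sqrt_inner)

lemma vec_grad_L2: "u \<in> H1_0_vec \<Omega> \<Longrightarrow> vec_grad \<Omega> u \<in> L2 \<Omega>"
  unfolding vec_grad_def by (rule L2_vec_lambda) (auto simp: H1_0_vec_def H1_0_def weak_grad_L2)

lemma bounded_linear_trace: "bounded_linear (trace :: real^'n^'n \<Rightarrow> real)"
  by (simp add: linear_conv_bounded_linear[symmetric] linear_iff trace_def sum.distrib sum_distrib_left)

lemma bounded_linear_transpose: "bounded_linear (transpose :: real^'n^'m \<Rightarrow> real^'m^'n)"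
  by (simp add: linear_conv_bounded_linear[symmetric] linear_iff transpose_def vec_eq_iff)

lemma weak_div_L2: "u \<in> H1_0_vec \<Omega> \<Longrightarrow> weak_div \<Omega> u \<in> L2 \<Omega>"
  unfolding weak_div_def by (intro L2_bounded_linear_image[OF vec_grad_L2 bounded_linear_trace])

lemma integral_inner_transpose_vec_grad:
  assumes \<Omega>: "open \<Omega>" "bounded \<Omega>" and u: "u \<in> H1_0_vec \<Omega>"
  shows "(LINT x|lebesgue_on \<Omega>. vec_grad \<Omega> u x \<bullet> transpose (vec_grad \<Omega> u x)) = (L2_norm \<Omega> (weak_div \<Omega> u))\<^sup>2"
proof -
  let ?g = "\<lambda>i. weak_grad \<Omega> (\<lambda>y. u y $ i)"
  have H: "(\<lambda>y. u y $ i) \<in> H1_0 \<Omega>" "(\<lambda>y. u y $ i) \<in> H1 \<Omega>" for i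
    using u by (auto simp: H1_0_vec_def H1_0_def)
  have comp: "(\<lambda>x. ?g i x $ j) \<in> L2 \<Omega>" for i j
    by (rule L2_bounded_linear_image[OF weak_grad_L2[OF H(2)] bounded_linear_vec_nth])
  have int: "integrable (lebesgue_on \<Omega>) (\<lambda>x. ?g i x $ j * ?g k x $ l)" for i j k l
    using integrable_inner_L2[OF comp comp] by simp
  have "(LINT x|lebesgue_on \<Omega>. vec_grad \<Omega> u x \<bullet> transpose (vec_grad \<Omega> u x)) =
      (\<Sum>i\<in>UNIV. \<Sum>j\<in>UNIV. LINT x|lebesgue_on \<Omega>. ?g i x $ j * ?g j x $ i)"
    by (simp add: inner_vec_def transpose_def vec_grad_def int)
  \<comment> \<open>The two derivative directions are exchanged while the components stay; the
    double sum then factors into the square of the trace.\<close>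
  also have "\<dots> = (\<Sum>i\<in>UNIV. \<Sum>j\<in>UNIV. LINT x|lebesgue_on \<Omega>. ?g i x $ i * ?g j x $ j)"
    by (intro sum.cong refl integral_weak_grad_swap[OF \<Omega> H(1) H(2)])
  also have "\<dots> = (L2_norm \<Omega> (weak_div \<Omega> u))\<^sup>2"
    by (simp add: L2_norm_power2 weak_div_def trace_def vec_grad_def sum_product int)
  finally show ?thesis .
qed

text \<open>The constant is 1, and not the dimension that Cauchy-Schwarz on the trace would give,
  because the squared divergence is first rewritten as the integral of
  \<open>G \<bullet> transpose G\<close> with \<open>G = vec_grad \<Omega> u\<close>.\<close>

lemma L2_norm_weak_div_le:
  assumes \<Omega>: "open \<Omega>" "bounded \<Omega>" and u: "u \<in> H1_0_vec \<Omega>"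
  shows "(L2_norm \<Omega> (weak_div \<Omega> u))\<^sup>2 \<le> (L2_norm \<Omega> (vec_grad \<Omega> u))\<^sup>2"
  unfolding integral_inner_transpose_vec_grad[OF \<Omega> u, symmetric] L2_norm_power2[of _ "vec_grad \<Omega> u"]
  using vec_grad_L2[OF u] L2_bounded_linear_image[OF vec_grad_L2[OF u] bounded_linear_transpose]
  by (intro integral_mono integrable_inner_L2 inner_transpose_le)

text \<open>Korn's identity inserted into \<open>form_a\<close>: the symmetric gradient contributes
  half of each squared norm, hence the coefficient \<open>1/2 + \<alpha>\<close>.\<close>

lemma form_a_eq:
  assumes \<Omega>: "open \<Omega>" "bounded \<Omega>" and u: "u \<in> H1_0_vec \<Omega>"
  shows "form_a \<Omega> \<alpha> u u =
    (L2_norm \<Omega> (vec_grad \<Omega> u))\<^sup>2 / 2 + (1/2 + \<alpha>) * (L2_norm \<Omega> (weak_div \<Omega> u))\<^sup>2"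
proof -
  let ?G = "vec_grad \<Omega> u" and ?d = "weak_div \<Omega> u"
  note G = vec_grad_L2[OF u] and Gt = L2_bounded_linear_image[OF vec_grad_L2[OF u] bounded_linear_transpose]
  note [simp] = integrable_inner_L2[OF G G] integrable_inner_L2[OF G Gt]
    integrable_inner_L2[OF weak_div_L2[OF u] weak_div_L2[OF u], simplified]
  have "form_a \<Omega> \<alpha> u u = (LINT x|lebesgue_on \<Omega>.
      (?G x \<bullet> ?G x + ?G x \<bullet> transpose (?G x)) / 2 + \<alpha> * (?d x * ?d x))"
    unfolding form_a_def sym_grad_def inner_sym_part by (simp add: mult.assoc)
  also have "\<dots> = ((L2_norm \<Omega> ?G)\<^sup>2 + (L2_norm \<Omega> ?d)\<^sup>2) / 2 + \<alpha> * (L2_norm \<Omega> ?d)\<^sup>2"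
    using integral_inner_transpose_vec_grad[OF \<Omega> u]
    by (simp add: L2_norm_power2)
  finally show ?thesis by (simp add: field_simps)
qed

lemma form_a_commute: "form_a \<Omega> \<alpha> u v = form_a \<Omega> \<alpha> v u"
  by (simp add: form_a_def inner_commute mult.commute mult.left_commute)

lemma c_upper_ge_1: "-1/3 \<le> \<alpha> \<Longrightarrow> 1 \<le> c_upper \<alpha>"
  by (auto simp: c_upper_def field_simps)

lemma weak_div_le_form_a:
  assumes \<Omega>: "open \<Omega>" "bounded \<Omega>" and u: "u \<in> H1_0_vec \<Omega>" and \<alpha>: "-1/3 \<le> \<alpha>"
  shows "(L2_norm \<Omega> (weak_div \<Omega> u))\<^sup>2 \<le> c_upper \<alpha> * form_a \<Omega> \<alpha> u u"
proof -
  let ?D = "(L2_norm \<Omega> (weak_div \<Omega> u))\<^sup>2"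
  \<comment> \<open>Half of the squared gradient norm is bounded below by half of \<open>?D\<close>.
    For negative \<open>\<alpha>\<close> the factor \<open>1 + \<alpha>\<close> is
    \<open>1 / c_upper \<alpha>\<close>; otherwise it is at least 1.\<close>
  have le: "(1 + \<alpha>) * ?D \<le> form_a \<Omega> \<alpha> u u"
    using L2_norm_weak_div_le[OF \<Omega> u] by (simp add: form_a_eq[OF \<Omega> u] algebra_simps)
  show ?thesis
  proof (cases "\<alpha> < 0")
    case True
    then show ?thesis using le \<alpha> by (simp add: c_upper_def field_simps)
  next
    case False
    then have "?D \<le> (1 + \<alpha>) * ?D" by (simp add: distrib_right)
    also note le
    finally show ?thesis using False by (simp add: c_upper_def)
  qed
qed

lemma form_a_le:
  assumes \<Omega>: "open \<Omega>" "bounded \<Omega>" and u: "u \<in> H1_0_vec \<Omega>"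
  shows "form_a \<Omega> \<alpha> u u \<le> (1 + \<bar>\<alpha>\<bar>) * (L2_norm \<Omega> (vec_grad \<Omega> u))\<^sup>2"
proof -
  let ?D = "(L2_norm \<Omega> (weak_div \<Omega> u))\<^sup>2" and ?N = "(L2_norm \<Omega> (vec_grad \<Omega> u))\<^sup>2"
  have DN: "?D \<le> ?N" by (rule L2_norm_weak_div_le[OF \<Omega> u])
  \<comment> \<open>Passing to \<open>\<bar>\<alpha>\<bar>\<close> makes the coefficient
    nonnegative, so that \<open>DN\<close> can be multiplied by it.\<close>
  have "(1/2 + \<alpha>) * ?D \<le> (1/2 + \<bar>\<alpha>\<bar>) * ?D" by (intro mult_right_mono) auto
  also have "\<dots> \<le> (1/2 + \<bar>\<alpha>\<bar>) * ?N" using DN by (intro mult_left_mono) auto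
  finally show ?thesis by (simp add: form_a_eq[OF \<Omega> u] algebra_simps)
qed

text \<open>Upper bound of the Schur complement by \<open>c_upper \<alpha>\<close> times the mass
  matrix, stated without inverting \<open>A\<close>: Cauchy-Schwarz, then the divergence is
  controlled by the energy.\<close>

lemma form_b_squared_le:
  assumes \<Omega>: "open \<Omega>" "bounded \<Omega>" and u: "u \<in> H1_0_vec \<Omega>" and \<alpha>: "-1/3 \<le> \<alpha>" and q: "q \<in> L2 \<Omega>"
  shows "(form_b \<Omega> q u)\<^sup>2 \<le> c_upper \<alpha> * (L2_norm \<Omega> q)\<^sup>2 * form_a \<Omega> \<alpha> u u"
proof -
  have "(form_b \<Omega> q u)\<^sup>2 \<le> (L2_norm \<Omega> q)\<^sup>2 * (L2_norm \<Omega> (weak_div \<Omega> u))\<^sup>2"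
    using L2_Cauchy_Schwarz[OF q weak_div_L2[OF u]] by (simp add: form_b_def)
  also have "\<dots> \<le> (L2_norm \<Omega> q)\<^sup>2 * (c_upper \<alpha> * form_a \<Omega> \<alpha> u u)"
    by (intro mult_left_mono weak_div_le_form_a[OF \<Omega> u \<alpha>]) auto
  finally show ?thesis by (simp add: mult_ac)
qed

text \<open>Poincare's inequality converts the lower bound on \<open>k\<close> into a bound of
  \<open>C\<close> from below by a multiple of the mass matrix; this is the source of the term
  \<open>cP * k_low\<close> in \<open>c_lower\<close>.\<close>

lemma form_c_ge:
  assumes \<Omega>: "open \<Omega>" and q: "q \<in> H1 \<Omega> \<inter> L2_mean_zero \<Omega>" and cP: "poincare \<Omega> cP"
    and k: "k \<in> borel_measurable (lebesgue_on \<Omega>)" "0 \<le> k_low" "\<forall>x\<in>\<Omega>. k_low \<le> k x \<and> k x \<le> k_up"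
  shows "cP * k_low * (L2_norm \<Omega> q)\<^sup>2 \<le> form_c \<Omega> k q q"
proof -
  let ?g = "weak_grad \<Omega> q"
  have g: "?g \<in> L2 \<Omega>" using q by (auto intro: weak_grad_L2)
  \<comment> \<open>The upper bound on \<open>k\<close> provides integrability, which the comparison
    of integrals below relies on.\<close>
  have "integrable (lebesgue_on \<Omega>) (\<lambda>x. k x * (?g x \<bullet> ?g x))"
  proof (rule Bochner_Integration.integrable_bound)
    show "integrable (lebesgue_on \<Omega>) (\<lambda>x. k_up * (?g x \<bullet> ?g x))"
      using integrable_inner_L2[OF g g] by simp
    show "AE x in lebesgue_on \<Omega>. norm (k x * (?g x \<bullet> ?g x)) \<le> norm (k_up * (?g x \<bullet> ?g x))"
      using k(2,3) by (intro AE_I2) (force simp: abs_mult intro!: mult_right_mono)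
  qed (use k g in \<open>auto simp: L2_def\<close>)
  then have "(LINT x|lebesgue_on \<Omega>. k_low * (?g x \<bullet> ?g x)) \<le> form_c \<Omega> k q q"
    unfolding form_c_def using integrable_inner_L2[OF g g] k(3)
    by (intro integral_mono) (auto intro!: mult_right_mono)
  then have "k_low * (L2_norm \<Omega> ?g)\<^sup>2 \<le> form_c \<Omega> k q q"
    by (simp add: L2_norm_power2)
  moreover have "k_low * (cP * (L2_norm \<Omega> q)\<^sup>2) \<le> k_low * (L2_norm \<Omega> ?g)\<^sup>2"
    using cP q k(2) by (intro mult_left_mono) (auto simp: poincare_def)
  ultimately show ?thesis by (simp add: mult_ac)
qed

section \<open>Semidefinite matrices and the block eigenvalue problem\<close>

lemma inner_vector_matrix_mult:
  fixes M :: "real^'n^'m"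
  shows "(q v* M) \<bullet> v = (M *v v) \<bullet> q"
  by (metis dot_lmul_matrix inner_commute)

lemma psd_Cauchy_Schwarz:
  fixes M :: "real^'n^'n"
  assumes sym: "transpose M = M" and psd: "\<And>v. 0 \<le> (M *v v) \<bullet> v"
  shows "((M *v v) \<bullet> w)\<^sup>2 \<le> ((M *v v) \<bullet> v) * ((M *v w) \<bullet> w)"
proof (rule quadratic_nonneg_imp_discriminant)
  fix t :: real
  have "(M *v w) \<bullet> v = (M *v v) \<bullet> w" using inner_vector_matrix_mult[of w M v] transpose_matrix_vector[of M w] sym by simp
  then have "(M *v (v + t *\<^sub>R w)) \<bullet> (v + t *\<^sub>R w) =
      (M *v v) \<bullet> v + 2 * ((M *v v) \<bullet> w) * t + ((M *v w) \<bullet> w) * t\<^sup>2"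
    by (simp add: matrix_vector_right_distrib matrix_vector_mult_scaleR inner_add power2_eq_square algebra_simps)
  then show "0 \<le> (M *v v) \<bullet> v + 2 * ((M *v v) \<bullet> w) * t + ((M *v w) \<bullet> w) * t\<^sup>2"
    using psd by metis
qed

lemma sum_UNIV_Plus:
  fixes f :: "'a::finite + 'b::finite \<Rightarrow> 'c::comm_monoid_add"
  shows "sum f UNIV = (\<Sum>i\<in>UNIV. f (Inl i)) + (\<Sum>j\<in>UNIV. f (Inr j))"
  by (simp add: UNIV_Plus_UNIV[symmetric] sum.Plus del: UNIV_Plus_UNIV)

lemma block_mat_vector_mult:
  fixes x :: "real^('n::finite + 'k::finite)" and E :: "real^'n^'m::finite" and H :: "real^'k^'l::finite"
  defines "v \<equiv> \<chi> i. x $ Inl i" and "q \<equiv> \<chi> j. x $ Inr j"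
  shows "(block_mat E F G H *v x) $ Inl r = (E *v v + F *v q) $ r"
    and "(block_mat E F G H *v x) $ Inr s = (G *v v + H *v q) $ s"
  by (simp_all add: matrix_vector_mult_def block_mat_def sum_UNIV_Plus v_def q_def)

lemma gen_eigenvalue_saddle_pointE:
  assumes "gen_eigenvalue (block_mat A (transpose B) B (- C)) (block_mat P 0 0 T) \<mu>"
  obtains v q where "v \<noteq> 0 \<or> q \<noteq> 0"
    "A *v v + transpose B *v q = \<mu> *\<^sub>R (P *v v)" "B *v v - C *v q = \<mu> *\<^sub>R (T *v q)"
proof -
  obtain x where x: "x \<noteq> 0"
    "block_mat A (transpose B) B (- C) *v x = \<mu> *\<^sub>R (block_mat P 0 0 T *v x)"
    using assms by (auto simp: gen_eigenvalue_def)
  define v where "v = (\<chi> i. x $ Inl i)"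
  define q where "q = (\<chi> j. x $ Inr j)"
  have "v \<noteq> 0 \<or> q \<noteq> 0"
  proof (rule ccontr)
    assume "\<not> (v \<noteq> 0 \<or> q \<noteq> 0)"
    then have "x $ i = 0" for i by (cases i) (auto simp: v_def q_def vec_eq_iff)
    with x(1) show False by (simp add: vec_eq_iff)
  qed
  moreover have "A *v v + transpose B *v q = \<mu> *\<^sub>R (P *v v)"
  proof -
    have "(A *v v + transpose B *v q) $ r = (\<mu> *\<^sub>R (P *v v)) $ r" for r
      using arg_cong[OF x(2), of "\<lambda>y. y $ Inl r"]
      by (simp add: block_mat_vector_mult v_def q_def)
    then show ?thesis by (simp add: vec_eq_iff)
  qed
  moreover have "B *v v - C *v q = \<mu> *\<^sub>R (T *v q)"
  proof -
    \<comment> \<open>The distributive law instantiated with the zero matrix serves as the rule for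
      \<open>- C\<close> applied to a vector.\<close>
    have "(B *v v - C *v q) $ r = (\<mu> *\<^sub>R (T *v q)) $ r" for r
      using arg_cong[OF x(2), of "\<lambda>y. y $ Inr r"]
      by (simp add: block_mat_vector_mult v_def q_def
        matrix_vector_mult_diff_rdistrib[of 0 C, simplified])
    then show ?thesis by (simp add: vec_eq_iff)
  qed
  ultimately show ?thesis using that by blast
qed

section \<open>Eigenvalue bounds for an abstract saddle-point pencil\<close>

text \<open>Later \<open>c\<close> is \<open>c_upper \<alpha>\<close>, \<open>\<gamma>\<close> is
  \<open>c1^2 / (1 + \<bar>\<alpha>\<bar>)\<close> and \<open>\<kappa>\<close> is
  \<open>cP * k_low\<close>. Rayleigh quotients are multiplied out and so cover the zero vector too.
  \<open>B_bound\<close> and \<open>B_inf_sup\<close> bound the Schur complement from both sides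
  through its variational form.\<close>

locale saddle_point_pencil =
  fixes A P :: "real^'n^'n" and B :: "real^'n^'m" and C Q T :: "real^'m^'m"
    and a_low a_up t_low t_up c \<gamma> \<kappa> :: real
  assumes A_sym: "transpose A = A"
    and P: "sym_pos_def P"
    and T: "sym_pos_def T"
    and AP_low: "a_low * ((P *v v) \<bullet> v) \<le> (A *v v) \<bullet> v"
    and AP_up: "(A *v v) \<bullet> v \<le> a_up * ((P *v v) \<bullet> v)"
    and QT_low: "t_low * ((T *v q) \<bullet> q) \<le> (Q *v q) \<bullet> q + (C *v q) \<bullet> q"
    and QT_up: "(Q *v q) \<bullet> q + (C *v q) \<bullet> q \<le> t_up * ((T *v q) \<bullet> q)"
    and pos: "a_low > 0" "a_up > 0" "t_low > 0" "t_up > 0" "c \<ge> 1"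
    and Q_nonneg: "0 \<le> (Q *v q) \<bullet> q"
    and \<kappa>: "\<kappa> \<ge> 0" "\<kappa> * ((Q *v q) \<bullet> q) \<le> (C *v q) \<bullet> q"
    and B_bound: "((B *v v) \<bullet> q)\<^sup>2 \<le> c * ((Q *v q) \<bullet> q) * ((A *v v) \<bullet> v)"
    and B_inf_sup: "\<exists>w. w \<noteq> 0 \<and> \<gamma> * ((Q *v q) \<bullet> q) * ((A *v w) \<bullet> w) \<le> ((B *v w) \<bullet> q)\<^sup>2"
begin

lemma P_pos: "v \<noteq> 0 \<Longrightarrow> 0 < (P *v v) \<bullet> v" and P_sym: "transpose P = P"
  using P by (auto simp: sym_pos_def_def)

lemma T_pos: "q \<noteq> 0 \<Longrightarrow> 0 < (T *v q) \<bullet> q"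
  using T by (auto simp: sym_pos_def_def)

lemma P_nonneg: "0 \<le> (P *v v) \<bullet> v"
  using P_pos[of v] by (cases "v = 0") auto

lemma A_pos: "v \<noteq> 0 \<Longrightarrow> 0 < (A *v v) \<bullet> v"
  using AP_low[of v] P_pos[of v] pos(1) by (meson mult_pos_pos order_less_le_trans)

lemma A_nonneg: "0 \<le> (A *v v) \<bullet> v"
  using A_pos[of v] by (cases "v = 0") auto

lemma C_nonneg: "0 \<le> (C *v q) \<bullet> q"
  using \<kappa>(2)[of q] mult_nonneg_nonneg[OF \<kappa>(1) Q_nonneg[of q]] by linarith

context
  fixes v q \<mu>
  assumes nonzero: "v \<noteq> 0 \<or> q \<noteq> 0"
    and eq1: "A *v v + transpose B *v q = \<mu> *\<^sub>R (P *v v)"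
    and eq2: "B *v v - C *v q = \<mu> *\<^sub>R (T *v q)"
begin

lemma eq1_tested: "(A *v v) \<bullet> v + (B *v v) \<bullet> q = \<mu> * ((P *v v) \<bullet> v)"
  using arg_cong[OF eq1, of "\<lambda>x. x \<bullet> v"] by (simp add: inner_add_left inner_vector_matrix_mult)

lemma eq2_tested: "(B *v v) \<bullet> q - (C *v q) \<bullet> q = \<mu> * ((T *v q) \<bullet> q)"
  using arg_cong[OF eq2, of "\<lambda>x. x \<bullet> q"] by (simp add: inner_diff_left)

text \<open>For \<open>v = 0\<close> the tested second row would equate a nonpositive number with a
  positive one.\<close>

lemma positive_imp_v_nonzero:
  assumes "\<mu> > 0"
  shows "v \<noteq> 0"
proof
  assume "v = 0"
  with nonzero have "0 < (T *v q) \<bullet> q" by (intro T_pos) simp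
  then have "0 < \<mu> * ((T *v q) \<bullet> q)" using assms by simp
  then show False using eq2_tested C_nonneg[of q] \<open>v = 0\<close> by simp
qed

lemma negative_imp_q_nonzero:
  assumes "\<mu> < 0"
  shows "q \<noteq> 0"
proof
  assume "q = 0"
  with nonzero have "v \<noteq> 0" by simp
  then have "\<mu> * ((P *v v) \<bullet> v) < 0" using assms P_pos by (simp add: mult_neg_pos)
  then show False using eq1_tested A_nonneg[of v] \<open>q = 0\<close> by simp
qed

text \<open>For positive \<open>\<mu>\<close> the second row makes
  \<open>(B *v v) \<bullet> q\<close> nonnegative; dropping it from the first row leaves a Rayleigh
  quotient of \<open>A\<close> and \<open>P\<close>.\<close>

lemma positive_eigenvalue_lower:
  assumes "\<mu> > 0"
  shows "a_low \<le> \<mu>"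
proof -
  have p: "0 < (P *v v) \<bullet> v" using P_pos positive_imp_v_nonzero[OF assms] .
  have "0 \<le> \<mu> * ((T *v q) \<bullet> q)"
    using assms T_pos[of q] by (cases "q = 0") auto
  then have "(A *v v) \<bullet> v \<le> \<mu> * ((P *v v) \<bullet> v)"
    using eq1_tested eq2_tested C_nonneg[of q] by linarith
  then have "a_low * ((P *v v) \<bullet> v) \<le> \<mu> * ((P *v v) \<bullet> v)"
    using AP_low[of v] by linarith
  with p show ?thesis by simp
qed

text \<open>The first row times \<open>\<mu>\<close>, with \<open>\<mu> * b\<close> bounded by a
  multiple of \<open>a\<close>, gives a quadratic inequality for \<open>\<mu>\<close> that fails
  beyond \<open>a_up + c * t_up\<close>.\<close>

lemma positive_eigenvalue_upper:
  assumes "\<mu> > 0"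
  shows "\<mu> \<le> a_up + c * t_up"
proof -
  define a where "a = (A *v v) \<bullet> v"
  define p where "p = (P *v v) \<bullet> v"
  define b where "b = (B *v v) \<bullet> q"
  define n where "n = (Q *v q) \<bullet> q"
  define s where "s = (C *v q) \<bullet> q"
  define t where "t = (T *v q) \<bullet> q"
  have p: "0 < p" using P_pos positive_imp_v_nonzero[OF assms] by (simp add: p_def)
  have ab: "a + b = \<mu> * p" and bs: "b - s = \<mu> * t"
    using eq1_tested eq2_tested by (simp_all add: a_def b_def p_def s_def t_def)
  have s: "0 \<le> s" and a: "0 \<le> a" using C_nonneg A_nonneg by (auto simp: s_def a_def)
  have t: "0 \<le> t" using T_pos[of q] by (cases "q = 0") (auto simp: t_def)
  have b: "0 \<le> b" using bs s t assms mult_nonneg_nonneg[of \<mu> t] by linarith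
  have "\<mu> * (n + s) \<le> \<mu> * (t_up * t)"
    using QT_up[of q] assms by (simp add: n_def s_def t_def)
  also have "\<dots> = t_up * b - t_up * s"
    using arg_cong[OF bs, of "\<lambda>x. t_up * x"] by (simp add: algebra_simps)
  finally have "\<mu> * n + \<mu> * s + t_up * s \<le> t_up * b" by (simp add: algebra_simps)
  moreover have "0 \<le> \<mu> * s" "0 \<le> t_up * s" using assms s pos by auto
  ultimately have nb: "\<mu> * n \<le> t_up * b" by linarith
  \<comment> \<open>\<open>B_bound\<close> and \<open>nb\<close> together bound
    \<open>\<mu> * b^2\<close> by a multiple of \<open>b\<close>; one factor \<open>b\<close> is
    cancelled.\<close>
  have "\<mu> * b \<le> c * a * t_up"
  proof (cases "b = 0")
    case True
    then show ?thesis using pos a by simp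
  next
    case False
    have "b\<^sup>2 \<le> c * n * a" using B_bound[of v q] by (simp add: b_def n_def a_def)
    then have "\<mu> * b\<^sup>2 \<le> (c * a) * (\<mu> * n)"
      using mult_left_mono[of "b\<^sup>2" "c * n * a" \<mu>] assms by (simp add: mult_ac)
    also have "\<dots> \<le> (c * a) * (t_up * b)"
      using nb a pos by (intro mult_left_mono) auto
    finally have "(\<mu> * b) * b \<le> (c * a * t_up) * b" by (simp add: power2_eq_square mult_ac)
    then show ?thesis using False b by simp
  qed
  then have "\<mu> * (\<mu> * p) \<le> a * (\<mu> + c * t_up)"
    unfolding ab[symmetric] by (simp add: algebra_simps)
  also have "\<dots> \<le> (a_up * p) * (\<mu> + c * t_up)"
    using AP_up[of v] assms pos by (intro mult_right_mono) (auto simp: a_def p_def)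
  finally have "(\<mu> * \<mu>) * p \<le> (a_up * (\<mu> + c * t_up)) * p" by (simp add: mult_ac)
  then have le: "\<mu> * \<mu> \<le> a_up * (\<mu> + c * t_up)" using p by simp
  show ?thesis
  proof (rule ccontr)
    assume "\<not> \<mu> \<le> a_up + c * t_up"
    then have gt: "a_up + c * t_up < \<mu>" by simp
    have ct: "0 < c * t_up" using pos by simp
    \<comment> \<open>Here \<open>a_up < \<mu>\<close>, so \<open>c * t_up * a_up\<close> may be
      replaced by \<open>c * t_up * \<mu>\<close>.\<close>
    have "a_up * (\<mu> + c * t_up) \<le> (a_up + c * t_up) * \<mu>"
      using gt ct pos mult_left_mono[of a_up \<mu> "c * t_up"] by (simp add: algebra_simps)
    also have "\<dots> < \<mu> * \<mu>" using gt assms by simp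
    finally show False using le by simp
  qed
qed

text \<open>The first row gives \<open>a \<le> - b\<close>, which turns \<open>B_bound\<close> into
  \<open>- b \<le> c * n\<close>. The second row then bounds \<open>- \<mu> * t\<close> by
  \<open>s + c * n\<close>.\<close>

lemma negative_eigenvalue_lower:
  assumes "\<mu> < 0"
  shows "- (c * t_up) \<le> \<mu>"
proof -
  define a where "a = (A *v v) \<bullet> v"
  define b where "b = (B *v v) \<bullet> q"
  define n where "n = (Q *v q) \<bullet> q"
  define s where "s = (C *v q) \<bullet> q"
  define t where "t = (T *v q) \<bullet> q"
  have t: "0 < t" using T_pos negative_imp_q_nonzero[OF assms] by (simp add: t_def)
  have bs: "b - s = \<mu> * t"
    using eq2_tested by (simp add: b_def s_def t_def)
  have n: "0 \<le> n" and s: "0 \<le> s" and a: "0 \<le> a"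
    using Q_nonneg C_nonneg A_nonneg by (auto simp: n_def s_def a_def)
  have "\<mu> * ((P *v v) \<bullet> v) \<le> 0" using assms P_nonneg by (simp add: mult_nonpos_nonneg)
  then have ab: "a \<le> - b" using eq1_tested by (simp add: a_def b_def)
  have "- b \<le> c * n"
  proof (cases "b = 0")
    case True
    then show ?thesis using n pos by simp
  next
    case False
    have "(- b) * (- b) \<le> (c * n) * a"
      using B_bound[of v q] by (simp add: b_def n_def a_def power2_eq_square)
    also have "\<dots> \<le> (c * n) * (- b)" using ab n pos by (intro mult_left_mono) auto
    finally show ?thesis using False ab a by (subst (asm) mult_le_cancel_right_pos) auto
  qed
  then have "(- \<mu>) * t \<le> s + c * n" using bs by simp
  \<comment> \<open>\<open>c \<ge> 1\<close> lets the same constant cover the contribution of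
    \<open>C\<close>.\<close>
  also have "\<dots> \<le> c * (n + s)" using mult_right_mono[OF pos(5) s] by (simp add: algebra_simps)
  also have "\<dots> \<le> c * (t_up * t)"
    using QT_up[of q] pos by (intro mult_left_mono) (auto simp: n_def s_def t_def)
  finally have "(- \<mu>) * t \<le> (c * t_up) * t" by simp
  then have "- \<mu> \<le> c * t_up" using t by (simp only: mult_le_cancel_right_pos)
  then show ?thesis by simp
qed

text \<open>The first row reads \<open>(A - \<mu> P) v = - B\<^sup>T q\<close> with \<open>A - \<mu> P\<close> positive definite for
  \<open>\<mu> < 0\<close>, so Cauchy--Schwarz in the inner product of \<open>A - \<mu> P\<close>, with the inf-sup
  vector as second argument, bounds \<open>- \<langle>Bv, q\<rangle>\<close> from below.\<close>

lemma inf_sup_energy_bound: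
  assumes "\<mu> < 0"
  shows "\<gamma> * ((Q *v q) \<bullet> q) * a_low \<le> - ((B *v v) \<bullet> q) * (a_low - \<mu>)"
proof -
  define S where "S = A - \<mu> *\<^sub>R P"
  have Sv: "S *v x = A *v x - \<mu> *\<^sub>R (P *v x)" for x
    by (simp add: S_def matrix_vector_mult_diff_rdistrib scaleR_matrix_vector_assoc)
  have S_nonneg: "0 \<le> (S *v x) \<bullet> x" for x
    using A_nonneg[of x] P_nonneg[of x] assms mult_nonpos_nonneg[of \<mu> "(P *v x) \<bullet> x"]
    by (simp add: Sv inner_diff_left)
  have S_sym: "transpose S = S"
    using A_sym P_sym by (simp add: S_def transpose_def vec_eq_iff)
  obtain w where w: "w \<noteq> 0" "\<gamma> * ((Q *v q) \<bullet> q) * ((A *v w) \<bullet> w) \<le> ((B *v w) \<bullet> q)\<^sup>2"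
    using B_inf_sup by blast
  have row: "S *v v = - (transpose B *v q)"
    using eq1 by (simp add: Sv algebra_simps eq_neg_iff_add_eq_0)
  have "(S *v v) \<bullet> w = - ((B *v w) \<bullet> q)"
    by (simp add: row inner_vector_matrix_mult)
  moreover have Svv: "(S *v v) \<bullet> v = - ((B *v v) \<bullet> q)"
    by (simp add: row inner_vector_matrix_mult)
  ultimately have "((B *v w) \<bullet> q)\<^sup>2 \<le> - ((B *v v) \<bullet> q) * ((S *v w) \<bullet> w)"
    using psd_Cauchy_Schwarz[OF S_sym S_nonneg, of v w] by simp
  then have le: "a_low * (\<gamma> * ((Q *v q) \<bullet> q) * ((A *v w) \<bullet> w)) \<le>
      a_low * (- ((B *v v) \<bullet> q) * ((S *v w) \<bullet> w))"
    using w(2) pos by (intro mult_left_mono) auto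
  \<comment> \<open>Since \<open>a_low * P\<close> lies below \<open>A\<close> as a form,
    \<open>a_low * S\<close> lies below \<open>(a_low - \<mu>) * A\<close>.\<close>
  have "- \<mu> * (a_low * ((P *v w) \<bullet> w)) \<le> - \<mu> * ((A *v w) \<bullet> w)"
    using AP_low[of w] assms by (intro mult_left_mono) auto
  then have "a_low * ((S *v w) \<bullet> w) \<le> (a_low - \<mu>) * ((A *v w) \<bullet> w)"
    by (simp add: Sv inner_diff_left algebra_simps)
  then have "- ((B *v v) \<bullet> q) * (a_low * ((S *v w) \<bullet> w)) \<le> - ((B *v v) \<bullet> q) * ((a_low - \<mu>) * ((A *v w) \<bullet> w))"
    using S_nonneg[of v] Svv by (intro mult_left_mono) auto
  with le have "(\<gamma> * ((Q *v q) \<bullet> q) * a_low) * ((A *v w) \<bullet> w) \<le>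
      (- ((B *v v) \<bullet> q) * (a_low - \<mu>)) * ((A *v w) \<bullet> w)"
    by (simp add: mult_ac)
  then show ?thesis using A_pos[OF w(1)] by (simp only: mult_le_cancel_right_pos)
qed

text \<open>The two conditions on \<open>d\<close> say that it is at most both terms of the minimum
  in \<open>c_lower\<close>. The second row times \<open>a_low - \<mu>\<close>, with the energy
  bound, gives a quadratic inequality whose negative root is the claimed bound when \<open>d\<close>
  is positive.\<close>

lemma negative_eigenvalue_upper:
  assumes \<mu>: "\<mu> < 0" and d: "d \<le> 1" "d * (1 + \<kappa>) \<le> \<gamma> + \<kappa>"
  shows "\<mu> \<le> 1/2 * (a_low - sqrt (a_low\<^sup>2 + 4 * d * t_low * a_low))"
proof -
  define b where "b = (B *v v) \<bullet> q"
  define n where "n = (Q *v q) \<bullet> q"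
  define s where "s = (C *v q) \<bullet> q"
  define t where "t = (T *v q) \<bullet> q"
  have t: "0 < t" using T_pos negative_imp_q_nonzero[OF \<mu>] by (simp add: t_def)
  have bs: "b - s = \<mu> * t"
    using eq2_tested by (simp add: b_def s_def t_def)
  have n: "0 \<le> n" and s: "0 \<le> s"
    using Q_nonneg C_nonneg by (auto simp: n_def s_def)
  have ns: "\<kappa> * n \<le> s" using \<kappa>(2) by (simp add: n_def s_def)
  \<comment> \<open>The share \<open>(1 - d) * s\<close> is traded for
    \<open>(1 - d) * \<kappa> * n\<close>, which makes up for \<open>\<gamma>\<close> being possibly
    smaller than \<open>d\<close>.\<close>
  have split: "d * (n + s) \<le> s + \<gamma> * n"
  proof -
    have "(1 - d) * (\<kappa> * n) \<le> (1 - d) * s" using ns d by (intro mult_left_mono) auto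
    moreover have "d * (1 + \<kappa>) * n \<le> (\<gamma> + \<kappa>) * n" using d n by (intro mult_right_mono) auto
    ultimately show ?thesis by (simp add: algebra_simps)
  qed
  have "- \<mu> * (a_low - \<mu>) * t = (a_low - \<mu>) * s + - b * (a_low - \<mu>)"
    using arg_cong[OF bs, of "\<lambda>x. x * (a_low - \<mu>)"] by (simp add: algebra_simps)
  \<comment> \<open>The nonnegative part \<open>- \<mu> * s\<close> is dropped.\<close>
  also have "\<dots> \<ge> a_low * s + \<gamma> * n * a_low"
    using inf_sup_energy_bound[OF \<mu>] \<mu> s by (intro add_mono mult_right_mono) (auto simp: b_def n_def)
  also have "a_low * s + \<gamma> * n * a_low \<ge> a_low * (d * (n + s))"
    using mult_left_mono[OF split, of a_low] pos by (simp add: algebra_simps)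
  finally have main: "a_low * (d * (n + s)) \<le> - \<mu> * (a_low - \<mu>) * t" .
  have "d * t_low * a_low \<le> - \<mu> * (a_low - \<mu>)"
  proof (cases "0 \<le> d")
    case True
    have "a_low * (d * (t_low * t)) \<le> a_low * (d * (n + s))"
      using QT_low[of q] pos True by (intro mult_left_mono) (auto simp: n_def s_def t_def)
    with main have "(d * t_low * a_low) * t \<le> (- \<mu> * (a_low - \<mu>)) * t" by (simp add: mult_ac)
    then show ?thesis using t by (simp only: mult_le_cancel_right_pos)
  next
    \<comment> \<open>\<open>QT_low\<close> can be scaled only by a nonnegative \<open>d\<close>;
      for negative \<open>d\<close> the signs alone decide.\<close>
    case False
    then have "d * t_low * a_low \<le> 0" using pos by (simp add: mult_nonpos_nonneg)
    also have "0 \<le> - \<mu> * (a_low - \<mu>)" using \<mu> pos by (intro mult_nonneg_nonneg) auto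
    finally show ?thesis .
  qed
  \<comment> \<open>Completing the square.\<close>
  then have "a_low\<^sup>2 + 4 * d * t_low * a_low \<le> (a_low - 2 * \<mu>)\<^sup>2"
    by (simp add: power2_eq_square algebra_simps)
  then have "sqrt (a_low\<^sup>2 + 4 * d * t_low * a_low) \<le> a_low - 2 * \<mu>"
    using \<mu> pos by (intro real_le_lsqrt) auto
  then show ?thesis by simp
qed

end

end

section \<open>The finite element matrices as an instance of the abstract pencil\<close>

theorem theorem4p4:
  fixes \<Omega> :: "(real^'d) set"
    and k :: "real^'d \<Rightarrow> real"
    and \<alpha> k_low k_up c1 cP dAP_low dAP_up dQT_low dQT_up :: real
    and Xh :: "(real^'d \<Rightarrow> real^'d) set"
    and Mh :: "(real^'d \<Rightarrow> real) set"
    and \<phi> :: "'nu::finite \<Rightarrow> real^'d \<Rightarrow> real^'d"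
    and \<psi> :: "'np::finite \<Rightarrow> real^'d \<Rightarrow> real"
    and A P :: "real^'nu^'nu"
    and B :: "real^'nu^'np"
    and C Q T :: "real^'np^'np"
  assumes dim: "CARD('d) \<in> {2, 3}"
    and \<Omega>: "domain \<Omega>" "bounded \<Omega>"
    and \<alpha>: "-1/3 \<le> \<alpha>" "\<alpha> \<le> 1000"
    and k_meas: "k \<in> borel_measurable (lebesgue_on \<Omega>)"
    and k_low: "0 \<le> k_low"
    and k_bounds: "\<forall>x\<in>\<Omega>. k_low \<le> k x \<and> k x \<le> k_up"
    and Xh: "Xh \<subseteq> H1_0_vec \<Omega>" "fe_basis \<Omega> \<phi> Xh"
    and Mh: "Mh \<subseteq> H1 \<Omega> \<inter> L2_mean_zero \<Omega>" "fe_basis \<Omega> \<psi> Mh"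
    and A: "\<forall>u v. (A *v u) \<bullet> v = form_a \<Omega> \<alpha> (fe_fun \<phi> u) (fe_fun \<phi> v)"
    and B: "\<forall>v q. (B *v v) \<bullet> q = form_b \<Omega> (fe_fun \<psi> q) (fe_fun \<phi> v)"
    and C: "\<forall>p q. (C *v p) \<bullet> q = form_c \<Omega> k (fe_fun \<psi> p) (fe_fun \<psi> q)"
    and Q: "\<forall>p q. (Q *v p) \<bullet> q = (LINT x|lebesgue_on \<Omega>. fe_fun \<psi> p x * fe_fun \<psi> q x)"
    and cP: "cP > 0" "poincare \<Omega> cP"
    and c1: "c1 > 0" "inf_sup \<Omega> Xh Mh c1"
    and P: "sym_pos_def P"
    and T: "sym_pos_def T"
    and deltas: "dAP_low > 0" "dAP_up > 0" "dQT_low > 0" "dQT_up > 0"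
    and AP: "\<forall>v. v \<noteq> 0 \<longrightarrow>
        dAP_low \<le> ((A *v v) \<bullet> v) / ((P *v v) \<bullet> v) \<and> ((A *v v) \<bullet> v) / ((P *v v) \<bullet> v) \<le> dAP_up"
    and QT: "\<forall>q. q \<noteq> 0 \<longrightarrow>
        dQT_low \<le> (((Q + C) *v q) \<bullet> q) / ((T *v q) \<bullet> q) \<and>
        (((Q + C) *v q) \<bullet> q) / ((T *v q) \<bullet> q) \<le> dQT_up"
  shows "\<forall>\<mu>. gen_eigenvalue (block_mat A (transpose B) B (- C)) (block_mat P 0 0 T) \<mu> \<longrightarrow>
      (\<mu> < 0 \<longrightarrow>
         - (c_upper \<alpha> * dQT_up) \<le> \<mu> \<and>
         \<mu> \<le> 1/2 * (dAP_low - sqrt (dAP_low\<^sup>2 + 4 * c_lower \<alpha> c1 cP k_low * dQT_low * dAP_low))) \<and>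
      (\<mu> > 0 \<longrightarrow>
         dAP_low \<le> \<mu> \<and> \<mu> \<le> dAP_up + c_upper \<alpha> * dQT_up)"
proof -
  note open\<Omega> = \<Omega>(1)[unfolded domain_def, THEN conjunct1]
  have X: "fe_fun \<phi> v \<in> H1_0_vec \<Omega>" for v using Xh by (auto simp: fe_basis_def)
  have M: "fe_fun \<psi> q \<in> H1 \<Omega> \<inter> L2_mean_zero \<Omega>" for q using Mh by (auto simp: fe_basis_def)
  have M_L2: "fe_fun \<psi> q \<in> L2 \<Omega>" for q using M by (auto simp: L2_mean_zero_def)
  have QN: "(Q *v q) \<bullet> q = (L2_norm \<Omega> (fe_fun \<psi> q))\<^sup>2" for q
    using Q by (simp add: L2_norm_power2)
  have AP': "dAP_low * ((P *v v) \<bullet> v) \<le> (A *v v) \<bullet> v \<and> (A *v v) \<bullet> v \<le> dAP_up * ((P *v v) \<bullet> v)" for v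
    using AP P by (cases "v = 0") (auto simp: sym_pos_def_def pos_le_divide_eq pos_divide_le_eq)
  have QT': "dQT_low * ((T *v q) \<bullet> q) \<le> (Q *v q) \<bullet> q + (C *v q) \<bullet> q \<and>
      (Q *v q) \<bullet> q + (C *v q) \<bullet> q \<le> dQT_up * ((T *v q) \<bullet> q)" for q
    using QT T by (cases "q = 0")
      (auto simp: sym_pos_def_def pos_le_divide_eq pos_divide_le_eq matrix_vector_mult_add_rdistrib inner_add_left)
  \<comment> \<open>The inf-sup constant is measured in the gradient norm; passing to the energy
    norm of \<open>A\<close> by \<open>form_a_le\<close> costs the factor
    \<open>1 + \<bar>\<alpha>\<bar>\<close> after squaring.\<close>
  define \<gamma> where "\<gamma> = c1\<^sup>2 / (1 + \<bar>\<alpha>\<bar>)"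
  interpret saddle_point_pencil A P B C Q T dAP_low dAP_up dQT_low dQT_up "c_upper \<alpha>" \<gamma> "cP * k_low"
  proof
    \<comment> \<open>Matrix entries are values of the form on coordinate vectors, so symmetry of
      \<open>form_a\<close> passes to \<open>A\<close>.\<close>
    have "(A *v axis j 1) \<bullet> axis i 1 = (A *v axis i 1) \<bullet> axis j 1" for i j
      using A form_a_commute by metis
    then show "transpose A = A"
      by (simp add: vec_eq_iff transpose_def matrix_vector_mult_basis inner_axis column_def)
    show "1 \<le> c_upper \<alpha>" using c_upper_ge_1 \<alpha> by simp
    show "cP * k_low * ((Q *v q) \<bullet> q) \<le> (C *v q) \<bullet> q" for q
      using form_c_ge[OF open\<Omega> M cP(2) k_meas k_low k_bounds] C by (simp add: QN)
    show "((B *v v) \<bullet> q)\<^sup>2 \<le> c_upper \<alpha> * ((Q *v q) \<bullet> q) * ((A *v v) \<bullet> v)" for v q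
      using form_b_squared_le[OF open\<Omega> \<Omega>(2) X \<alpha>(1) M_L2] A B by (simp add: QN)
    show "\<exists>w. w \<noteq> 0 \<and> \<gamma> * ((Q *v q) \<bullet> q) * ((A *v w) \<bullet> w) \<le> ((B *v w) \<bullet> q)\<^sup>2" for q
    proof -
      let ?q = "L2_norm \<Omega> (fe_fun \<psi> q)"
      have "fe_fun \<psi> q \<in> Mh" using Mh by (auto simp: fe_basis_def)
      then obtain u where u: "u \<in> Xh" "\<not> ae_zero \<Omega> u"
        "c1 * ?q \<le> form_b \<Omega> (fe_fun \<psi> q) u / L2_norm \<Omega> (vec_grad \<Omega> u)"
        using c1(2) unfolding inf_sup_def by blast
      obtain w where w: "u = fe_fun \<phi> w" using u(1) Xh by (auto simp: fe_basis_def)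
      let ?g = "L2_norm \<Omega> (vec_grad \<Omega> u)" and ?b = "form_b \<Omega> (fe_fun \<psi> q) u"
      have "w \<noteq> 0" using u(2) by (auto simp: w fe_fun_def ae_zero_def)
      \<comment> \<open>For \<open>?g = 0\<close> the left side vanishes; otherwise the quotient in
        \<open>u(3)\<close> can be cleared.\<close>
      have "(c1 * ?q * ?g)\<^sup>2 \<le> ?b\<^sup>2"
      proof (cases "?g = 0")
        case False
        then have "0 < ?g" using L2_norm_nonneg[of \<Omega> "vec_grad \<Omega> u"] by simp
        then have "c1 * ?q * ?g \<le> ?b" using u(3) by (simp add: pos_le_divide_eq)
        then show ?thesis using c1(1) by (intro power_mono) (auto simp: L2_norm_nonneg)
      qed simp
      moreover have "\<gamma> * ?q\<^sup>2 * ((A *v w) \<bullet> w) \<le> (c1 * ?q * ?g)\<^sup>2"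
      proof -
        have "\<gamma> * ?q\<^sup>2 * ((A *v w) \<bullet> w) \<le> \<gamma> * ?q\<^sup>2 * ((1 + \<bar>\<alpha>\<bar>) * ?g\<^sup>2)"
          using form_a_le[OF open\<Omega> \<Omega>(2) X, of \<alpha> w] A by (intro mult_left_mono) (auto simp: w \<gamma>_def)
        also have "\<dots> = (\<gamma> * (1 + \<bar>\<alpha>\<bar>)) * (?q\<^sup>2 * ?g\<^sup>2)" by (simp only: mult_ac)
        also have "\<gamma> * (1 + \<bar>\<alpha>\<bar>) = c1\<^sup>2" by (simp add: \<gamma>_def)
        finally show ?thesis by (simp add: power_mult_distrib mult_ac)
      qed
      ultimately show ?thesis using \<open>w \<noteq> 0\<close> B by (auto simp: QN w)
    qed
  qed (use P T AP' QT' deltas QN cP k_low in auto)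
  let ?d = "c_lower \<alpha> c1 cP k_low"
  have "0 \<le> cP * k_low" using cP k_low by simp
  \<comment> \<open>Cancelling \<open>1 + \<bar>\<alpha>\<bar>\<close> rewrites the quotient of
    \<open>c_lower\<close> in the constants of the pencil.\<close>
  then have "(c1\<^sup>2 + cP * k_low * (1 + \<bar>\<alpha>\<bar>)) / ((1 + \<bar>\<alpha>\<bar>) * (1 + cP * k_low)) = (\<gamma> + cP * k_low) / (1 + cP * k_low)"
    by (simp add: \<gamma>_def add_divide_distrib)
  then have "?d \<le> (\<gamma> + cP * k_low) / (1 + cP * k_low)" "?d \<le> 1"
    by (simp_all add: c_lower_def)
  then have d: "?d \<le> 1" "?d * (1 + cP * k_low) \<le> \<gamma> + cP * k_low"
    using \<open>0 \<le> cP * k_low\<close> by (simp_all add: pos_le_divide_eq)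
  show ?thesis
  proof (intro allI impI)
    fix \<mu>
    assume "gen_eigenvalue (block_mat A (transpose B) B (- C)) (block_mat P 0 0 T) \<mu>"
    then obtain v q where vq: "v \<noteq> 0 \<or> q \<noteq> 0"
      "A *v v + transpose B *v q = \<mu> *\<^sub>R (P *v v)" "B *v v - C *v q = \<mu> *\<^sub>R (T *v q)"
      by (rule gen_eigenvalue_saddle_pointE)
    show "(\<mu> < 0 \<longrightarrow>
         - (c_upper \<alpha> * dQT_up) \<le> \<mu> \<and>
         \<mu> \<le> 1/2 * (dAP_low - sqrt (dAP_low\<^sup>2 + 4 * ?d * dQT_low * dAP_low))) \<and>
      (\<mu> > 0 \<longrightarrow> dAP_low \<le> \<mu> \<and> \<mu> \<le> dAP_up + c_upper \<alpha> * dQT_up)"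
      using negative_eigenvalue_lower[OF vq] negative_eigenvalue_upper[OF vq _ d]
        positive_eigenvalue_lower[OF vq] positive_eigenvalue_upper[OF vq] by blast
  qed
qed

end
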